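(* Let $d\geq 2$ be an integer and $\beta>1/2$. Then for any $N$ points $\mathbf{x}_1,\dots,\mathbf{x}_N$ on $\mathbb{S}^d$ one has $$\int_{-1}^1\int_{\mathbb{S}^d}\left|\frac1N\sum_{j=1}^N(\mathbf{x}_j\cdot\mathbf{z}-t)_+^{\beta-1}-\int_{\mathbb{S}^d}(\mathbf{y}\cdot\mathbf{z}-t)_+^{\beta-1}\,\mathrm{d}\sigma_d(\mathbf{y})\right|^2\mathrm{d}\sigma_d(\mathbf{z})\,\mathrm{d}t$$ $$=\frac1{N^2}\sum_{j=1}^N\sum_{k=1}^N\mathcal{K}_\beta(\mathbf{x}_j,\mathbf{x}_k)-\int_{\mathbb{S}^d}\int_{\mathbb{S}^d}\mathcal{K}_\beta(\mathbf{x},\mathbf{y})\,\mathrm{d}\sigma_d(\mathbf{x})\,\mathrm{d}\sigma_d(\mathbf{y}).$$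
   Context: $\mathbb{S}^d$ is the unit sphere in $\mathbb{R}^{d+1}$ and $\sigma_d$ is the normalized surface measure on it ($\sigma_d(\mathbb{S}^d)=1$). The truncated power is $u_+^{\alpha}=u^\alpha$ for $u>0$ and $u_+^\alpha=0$ for $u<0$ (with $u_+^0=1$ for $u\ge 0$). The kernel $\mathcal{K}_\beta:\mathbb{S}^d\times\mathbb{S}^d\to\mathbb{R}$ is $$\mathcal{K}_\beta(\mathbf{x},\mathbf{y}) = \int_{-1}^1\int_{\mathbb{S}^d} (\mathbf{x}\cdot\mathbf{z}-t)_+^{\beta-1}(\mathbf{y}\cdot\mathbf{z}-t)_+^{\beta-1}\,\mathrm{d}\sigma_d(\mathbf{z})\,\mathrm{d}t .$$ *)

theory Defs
  imports "HOL-Analysis.Analysis"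
begin

text \<open>
  Normalized surface measure on the unit sphere of a Euclidean space, constructed by polar
  coordinates: the measure of a Borel set \<open>A\<close> of unit vectors is the proportion of the unit ball
  occupied by the cone \<open>{r *\<^sub>R a | 0 < r \<le> 1, a \<in> A}\<close>. Here \<open>sgn x = x /\<^sub>R norm x\<close>; the origin,
  where \<open>sgn 0 = 0\<close> is not a unit vector, is a null set. Below it is shown that the total mass
  is 1 and that the measure is invariant under orthogonal transformations.
\<close>

definition sphere_measure :: "'a::euclidean_space measure" where
  "sphere_measure =
     restrict_space (distr (uniform_measure lborel (cball 0 1)) borel sgn) (sphere 0 1)"

text \<open>
  At \<open>u = 0\<close> the value is 1 if \<open>\<alpha> = 0\<close>, and 0 otherwise. For \<open>\<alpha> < 0\<close> this is an arbitrary
  choice for a power that is not defined there.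
\<close>

definition trunc_power :: "real \<Rightarrow> real \<Rightarrow> real" where
  "trunc_power u \<alpha> = (if u > 0 then u powr \<alpha> else if u = 0 \<and> \<alpha> = 0 then 1 else 0)"

definition sphere_kernel :: "real \<Rightarrow> 'a::euclidean_space \<Rightarrow> 'a \<Rightarrow> real" where
  "sphere_kernel \<beta> x y =
     (LBINT t:{-1..1}. LINT z|sphere_measure.
        trunc_power (x \<bullet> z - t) (\<beta> - 1) * trunc_power (y \<bullet> z - t) (\<beta> - 1))"

lemma space_sphere_measure [simp]: "space sphere_measure = sphere 0 1"
  by (simp add: sphere_measure_def space_restrict_space)

lemma sets_sphere_measure: "sets sphere_measure = sets (restrict_space borel (sphere 0 1))"
  by (simp add: sphere_measure_def sets_restrict_space)

lemma emeasure_sphere_measure: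
  fixes A :: "'a::euclidean_space set"
  assumes "A \<in> sets borel" "A \<subseteq> sphere 0 1"
  shows "emeasure sphere_measure A =
           emeasure lborel (cball 0 1 \<inter> sgn -` A) / emeasure lborel (cball 0 1 :: 'a set)"
proof -
  have "emeasure sphere_measure A =
          emeasure (distr (uniform_measure lborel (cball 0 1)) borel sgn) A"
    unfolding sphere_measure_def using assms by (intro emeasure_restrict_space) auto
  also have "\<dots> = emeasure (uniform_measure lborel (cball 0 1)) (sgn -` A)"
    using assms by (subst emeasure_distr) auto
  also have "\<dots> = emeasure lborel (cball 0 1 \<inter> sgn -` A) / emeasure lborel (cball 0 1 :: 'a set)"
    using measurable_sets_borel[OF borel_measurable_sgn assms(1)]
    by (intro emeasure_uniform_measure) auto
  finally show ?thesis .
qed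

lemma emeasure_sphere_measure_space:
  "emeasure (sphere_measure :: 'a::euclidean_space measure) (sphere 0 1) = 1"
proof -
  let ?B = "cball 0 1 :: 'a set"
  have eq: "?B \<inter> sgn -` sphere 0 1 = ?B - {0}"
    by (auto simp: norm_sgn)
  have "emeasure lborel ?B = ennreal (measure lborel ?B)"
    using emeasure_lborel_cball_finite[of "0 :: 'a" 1] by (intro emeasure_eq_ennreal_measure) auto
  then have "emeasure lborel ?B > 0"
    using content_cball_pos[of 1 "0 :: 'a"] by simp
  moreover have "emeasure lborel ?B < \<infinity>"
    by (rule emeasure_lborel_cball_finite)
  moreover have "emeasure lborel (?B - {0}) = emeasure lborel ?B"
    by (subst emeasure_Diff) auto
  ultimately show ?thesis
    by (subst emeasure_sphere_measure) (auto simp: eq)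
qed

lemma emeasure_sphere_measure_orthogonal:
  fixes f :: "real ^ 'n::{finite,wellorder} \<Rightarrow> real ^ 'n::_"
  assumes f: "orthogonal_transformation f" and A: "A \<in> sets sphere_measure"
  shows "emeasure sphere_measure (f ` A) = emeasure sphere_measure A"
proof -
  have A': "A \<in> sets borel" "A \<subseteq> sphere 0 1"
    using A by (auto simp: sets_sphere_measure sets_restrict_space_iff)
  obtain g where g: "orthogonal_transformation g" and gf: "\<And>x. g (f x) = x" and fg: "\<And>x. f (g x) = x"
    using orthogonal_transformation_inv[OF f] orthogonal_transformation_bij[OF f]
    by (metis bij_inv_eq_iff)
  have lin: "linear f" "linear g"
    using f g by (auto simp: orthogonal_transformation_def)
  have nf: "norm (f x) = norm x" and ng: "norm (g x) = norm x" for x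
    using f g by (auto simp: orthogonal_transformation_norm)
  have gm: "g \<in> borel_measurable borel"
    using lin(2) by (intro borel_measurable_continuous_onI linear_continuous_on)
      (simp add: linear_conv_bounded_linear)
  have f_image: "f ` S = g -` S" for S
    by (auto simp: gf image_iff) (metis fg)
  note fA = f_image[of A]
  have fA': "f ` A \<in> sets borel" "f ` A \<subseteq> sphere 0 1"
    using A' nf measurable_sets_borel[OF gm A'(1)] by (auto simp: fA ng)
  have sg: "sgn (g x) = g (sgn x)" for x
    using lin(2) by (simp add: sgn_div_norm ng linear_scale)
  let ?C = "cball 0 1 \<inter> sgn -` A" and ?D = "cball 0 1 \<inter> sgn -` (f ` A)"
  have D: "?D = f ` ?C"
    by (subst f_image) (auto simp: fA sg ng)
  have C_sets: "?C \<in> sets borel" "?D \<in> sets borel"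
    using A'(1) fA'(1) by (auto intro!: sets.Int measurable_sets_borel[OF borel_measurable_sgn])
  have fin: "emeasure lborel ?C < \<infinity>" "emeasure lborel ?D < \<infinity>"
    by (rule order.strict_trans1[OF emeasure_mono emeasure_lborel_cball_finite[of 0 1]]; force)+
  have "?C \<in> lmeasurable"
    using C_sets fin by (auto simp: fmeasurable_def)
  then have "measure lebesgue ?D = measure lebesgue ?C"
    unfolding D by (rule measure_orthogonal_image[OF f])
  then have "emeasure lborel ?D = emeasure lborel ?C"
    using C_sets fin by (simp add: emeasure_eq_ennreal_measure)
  then show ?thesis
    using A' fA' by (simp add: emeasure_sphere_measure)
qed

end

theory Submission
  imports Defs "HOL-Probability.Probability_Measure"
begin

text \<open>
  Write \<open>f y t z = trunc_power (y \<bullet> z - t) (\<beta> - 1)\<close>. Invariance of the surface measure under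
  orthogonal maps, together with the symmetry of \<open>y \<bullet> z\<close>, shows that averaging \<open>f\<close> over \<open>y\<close> and
  averaging it over \<open>z\<close> give the same function \<open>m\<close> of \<open>t\<close> alone. So for almost every \<open>t\<close> the inner
  integral of the left-hand side is a variance, which equals the average of the integrals of
  \<open>f (x j) t z * f (x k) t z\<close> minus \<open>(m t)\<^sup>2\<close>; and by Fubini the double integral of the kernel is
  the integral of \<open>(m t)\<^sup>2\<close>. All integrals exist because \<open>2 * (\<beta> - 1) > -1\<close> makes \<open>f y\<close> square
  integrable with a bound independent of \<open>y\<close>.
\<close>

section \<open>Translation-invariant measures and the orthogonal invariance of Lebesgue
  measure\<close>

lemma nn_integral_lborel_diff:
  fixes f :: "'a::euclidean_space \<Rightarrow> ennreal"
  assumes [measurable]: "f \<in> borel_measurable borel"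
  shows "(\<integral>\<^sup>+y. f (c - y) \<partial>lborel) = (\<integral>\<^sup>+y. f y \<partial>lborel)"
proof -
  have "(\<integral>\<^sup>+y. f y \<partial>lborel) = (\<integral>\<^sup>+y. f y \<partial>distr lborel borel (\<lambda>y. c + (-1) *\<^sub>R y))"
    using lborel_affine[of "-1" c] by (simp add: density_1)
  also have "\<dots> = (\<integral>\<^sup>+y. f (c - y) \<partial>lborel)"
    by (subst nn_integral_distr) auto
  finally show ?thesis ..
qed

text \<open>
  Uniqueness of translation-invariant measures, by evaluating the double integral of
  \<open>1\<^sub>A(x) 1\<^sub>B(x + y)\<close> in both orders.
\<close>

lemma emeasure_translation_invariant:
  fixes M :: "'a::euclidean_space measure"
  assumes sf: "sigma_finite_measure M" and sets[measurable_cong]: "sets M = sets borel"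
    and inv: "\<And>c. distr M borel ((+) c) = M"
    and [measurable]: "A \<in> sets borel" "B \<in> sets borel"
  shows "emeasure M A * emeasure lborel B = emeasure M B * emeasure lborel A"
proof -
  interpret M: sigma_finite_measure M by fact
  interpret pair_sigma_finite M "lborel :: 'a measure" ..
  let ?I = "\<lambda>A. indicator A :: 'a \<Rightarrow> ennreal"
  have shift: "(\<integral>\<^sup>+x. g x \<partial>M) = (\<integral>\<^sup>+x. g (c + x) \<partial>M)" if [measurable]: "g \<in> borel_measurable borel"
    for g and c
    by (subst inv[symmetric, of c], subst nn_integral_distr) auto
  have shift': "(\<integral>\<^sup>+x. g x \<partial>lborel) = (\<integral>\<^sup>+x. g (c + x) \<partial>lborel)"
    if [measurable]: "g \<in> borel_measurable borel" for g and c :: 'a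
    by (subst lborel_distr_plus[symmetric, of c], subst nn_integral_distr) auto
  have "emeasure M A * emeasure lborel B = (\<integral>\<^sup>+x. \<integral>\<^sup>+y. ?I A x * ?I B y \<partial>lborel \<partial>M)"
    by (simp add: nn_integral_cmult nn_integral_multc sets)
  \<comment> \<open>For fixed \<open>x\<close>, Lebesgue measure is translated by \<open>x\<close>;
    the factor \<open>?I A x\<close> is constant in \<open>y\<close>.\<close>
  also have "\<dots> = (\<integral>\<^sup>+x. \<integral>\<^sup>+y. ?I A x * ?I B (x + y) \<partial>lborel \<partial>M)"
    by (intro nn_integral_cong shift') auto
  also have "\<dots> = (\<integral>\<^sup>+y. \<integral>\<^sup>+x. ?I A x * ?I B (x + y) \<partial>M \<partial>lborel)"
    by (rule Fubini'[symmetric]) simp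
  \<comment> \<open>Now invariance of \<open>M\<close> under translation by \<open>- y\<close> moves
    the shift from \<open>B\<close> to \<open>A\<close>.\<close>
  also have "\<dots> = (\<integral>\<^sup>+y. \<integral>\<^sup>+x. ?I A (x - y) * ?I B x \<partial>M \<partial>lborel)"
  proof (rule nn_integral_cong)
    fix y :: 'a
    show "(\<integral>\<^sup>+x. ?I A x * ?I B (x + y) \<partial>M) = (\<integral>\<^sup>+x. ?I A (x - y) * ?I B x \<partial>M)"
      using shift[of "\<lambda>x. ?I A x * ?I B (x + y)" "- y"] by simp
  qed
  also have "\<dots> = (\<integral>\<^sup>+x. \<integral>\<^sup>+y. ?I A (x - y) * ?I B x \<partial>lborel \<partial>M)"
    by (rule Fubini') simp
  \<comment> \<open>The reflection \<open>y\<close> to \<open>x - y\<close> preserves Lebesgue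
    measure, so the inner integral no longer depends on \<open>x\<close> through
    \<open>A\<close>.\<close>
  also have "\<dots> = (\<integral>\<^sup>+x. emeasure lborel A * ?I B x \<partial>M)"
    using nn_integral_lborel_diff[of "?I A"]
    by (intro nn_integral_cong) (simp add: nn_integral_multc)
  also have "\<dots> = emeasure M B * emeasure lborel A"
    by (subst nn_integral_cmult) (auto simp: sets mult.commute)
  finally show ?thesis .
qed

text \<open>
  The library's \<open>measure_orthogonal_image\<close> needs a well-ordered index type, hence the detour
  through translation invariance.
\<close>

lemma distr_lborel_orthogonal_transformation:
  fixes f :: "'a::euclidean_space \<Rightarrow> 'a"
  assumes f: "orthogonal_transformation f"
  shows "distr lborel borel f = lborel"
proof -
  let ?M = "distr lborel borel f" and ?B = "cball 0 1 :: 'a set"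
  have lin: "linear f" and nf: "\<And>x. norm (f x) = norm x"
    using f by (auto simp: orthogonal_transformation_def orthogonal_transformation_norm)
  have fm[measurable]: "f \<in> borel_measurable borel"
    using lin by (intro borel_measurable_continuous_onI linear_continuous_on)
      (simp add: linear_conv_bounded_linear)
  \<comment> \<open>Centred balls are their own preimages under \<open>f\<close>. This gives an
    exhaustion by sets of finite measure and also shows that the proportionality constant between
    \<open>?M\<close> and \<open>lborel\<close> is 1.\<close>
  have ball: "emeasure ?M (cball 0 r) = emeasure lborel (cball 0 r :: 'a set)" for r
  proof -
    have "f -` cball 0 r = cball 0 r" by (auto simp: nf)
    then show ?thesis by (simp add: emeasure_distr)
  qed
  have sf: "sigma_finite_measure ?M"
  proof (intro sigma_finite_measure.intro exI conjI ballI)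
    show "countable (range (\<lambda>n::nat. cball 0 (real n) :: 'a set))" by simp
    show "\<Union> (range (\<lambda>n::nat. cball 0 (real n) :: 'a set)) = space ?M"
      by (auto intro: real_arch_simple)
  next
    fix a assume "a \<in> range (\<lambda>n::nat. cball 0 (real n) :: 'a set)"
    then show "emeasure ?M a \<noteq> \<infinity>"
      using emeasure_lborel_cball_finite[of "0::'a"] by (auto simp: ball less_top)
  qed auto
  \<comment> \<open>By linearity, translating by \<open>c = f b\<close> after \<open>f\<close> is
    the same as translating by \<open>b\<close> before it.\<close>
  have inv: "distr ?M borel ((+) c) = ?M" for c
  proof -
    obtain b where b: "f b = c"
      using orthogonal_transformation_surj[OF f] by (metis surjD)
    have "distr ?M borel ((+) c) = distr lborel borel (\<lambda>x. f (b + x))"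
      by (subst distr_distr) (auto simp: o_def linear_add[OF lin] b)
    also have "\<dots> = distr (distr lborel borel ((+) b)) borel f"
      by (subst distr_distr) (auto simp: o_def)
    finally show ?thesis by (simp add: lborel_distr_plus)
  qed
  have pos: "emeasure lborel ?B \<noteq> 0" and fin: "emeasure lborel ?B \<noteq> \<infinity>"
    using content_cball_pos[of 1 "0 :: 'a"] emeasure_lborel_cball_finite[of "0 :: 'a" 1]
    by (auto simp: measure_def)
  show ?thesis
  proof (rule measure_eqI)
    fix A assume "A \<in> sets ?M"
    then have "emeasure ?M A * emeasure lborel ?B = emeasure lborel A * emeasure lborel ?B"
      using emeasure_translation_invariant[OF sf _ inv, of A ?B] by (simp add: ball mult.commute)
    then show "emeasure ?M A = emeasure lborel A"
      using pos fin ennreal_mult_cancel_left[of "emeasure lborel ?B"]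
      by (metis infinity_ennreal_def mult.commute)
  qed simp
qed

section \<open>The surface measure and its orthogonal invariance\<close>

lemma sets_sphere_measureD:
  assumes "A \<in> sets (sphere_measure :: 'a::euclidean_space measure)"
  shows "A \<in> sets borel" "A \<subseteq> sphere 0 1"
  using assms by (auto simp: sets_sphere_measure sets_restrict_space_iff)

lemma measurable_ident_sphere_measure [measurable]:
  "(\<lambda>x. x) \<in> borel_measurable (sphere_measure :: 'a::euclidean_space measure)"
  by (simp add: measurable_cong_sets[OF sets_sphere_measure refl] measurable_restrict_space1)

lemma prob_space_sphere_measure:
  "prob_space (sphere_measure :: 'a::euclidean_space measure)"
  by (rule prob_spaceI) (simp add: emeasure_sphere_measure_space)

lemma measurable_sphere_measure_orthogonal_transformation:
  fixes f :: "'a::euclidean_space \<Rightarrow> 'a"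
  assumes f: "orthogonal_transformation f"
  shows "f \<in> measurable sphere_measure sphere_measure"
proof -
  have [measurable]: "f \<in> borel_measurable borel"
    using orthogonal_transformation_linear[OF f]
    by (intro borel_measurable_continuous_onI linear_continuous_on)
      (simp add: linear_conv_bounded_linear)
  show ?thesis
    unfolding measurable_cong_sets[OF sets_sphere_measure sets_sphere_measure]
    by (intro measurable_restrict_space3) (auto simp: orthogonal_transformation_norm[OF f])
qed

lemma distr_sphere_measure_orthogonal_transformation:
  fixes f :: "'a::euclidean_space \<Rightarrow> 'a"
  assumes f: "orthogonal_transformation f"
  shows "distr sphere_measure sphere_measure f = sphere_measure"
proof -
  have lin: "linear f" and nf: "\<And>x. norm (f x) = norm x"
    using f by (auto simp: orthogonal_transformation_def orthogonal_transformation_norm)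
  have fm[measurable]: "f \<in> borel_measurable borel"
    using lin by (intro borel_measurable_continuous_onI linear_continuous_on)
      (simp add: linear_conv_bounded_linear)
  have sg: "sgn (f x) = f (sgn x)" for x
    using lin by (simp add: sgn_div_norm nf linear_scale)
  note [measurable] = measurable_sphere_measure_orthogonal_transformation[OF f]
  show ?thesis
  proof (rule measure_eqI)
    fix A assume "A \<in> sets (distr sphere_measure sphere_measure f)"
    then have A: "A \<in> sets sphere_measure" by simp
    note A' = sets_sphere_measureD[OF A]
    let ?C = "cball 0 1 \<inter> sgn -` A"
    have [measurable]: "A \<in> sets borel" by (fact A')
    have C[measurable]: "?C \<in> sets borel"
      by (auto intro!: sets.Int measurable_sets_borel[OF borel_measurable_sgn])
    have sub: "f -` A \<subseteq> sphere 0 1" using A'(2) nf by fastforce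
    have "emeasure (distr sphere_measure sphere_measure f) A = emeasure sphere_measure (f -` A)"
      using A sub by (subst emeasure_distr) (auto simp: Int_absorb2)
    also have "\<dots> = emeasure lborel (cball 0 1 \<inter> sgn -` (f -` A)) / emeasure lborel (cball 0 1 :: 'a set)"
      using sub by (intro emeasure_sphere_measure measurable_sets_borel[OF fm]) auto
    also have "cball 0 1 \<inter> sgn -` (f -` A) = f -` ?C"
      by (auto simp: nf sg)
    also have "emeasure lborel (f -` ?C) = emeasure (distr lborel borel f) ?C"
      by (subst emeasure_distr) auto
    also have "\<dots> = emeasure lborel ?C"
      by (simp add: distr_lborel_orthogonal_transformation[OF f])
    finally show "emeasure (distr sphere_measure sphere_measure f) A = emeasure sphere_measure A"
      using A' by (simp add: emeasure_sphere_measure)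
  qed simp
qed

text \<open>The orthogonal group acts transitively on the sphere: a map \<open>f\<close> taking
  \<open>x\<close> to \<open>y\<close> serves as a change of variables and preserves inner
  products.\<close>

lemma integral_sphere_measure_zonal_eq:
  fixes h :: "real \<Rightarrow> real" and x y :: "real ^ 'n"
  assumes [measurable]: "h \<in> borel_measurable borel"
    and x: "x \<in> sphere 0 1" and y: "y \<in> sphere 0 1"
  shows "(LINT z|sphere_measure. h (x \<bullet> z)) = (LINT z|sphere_measure. h (y \<bullet> z))"
proof -
  obtain f where f: "orthogonal_transformation f" "f x = y"
    using orthogonal_transformation_exists_1[of x y] x y by auto
  note [measurable] = measurable_sphere_measure_orthogonal_transformation[OF f(1)]
  have "(LINT z|sphere_measure. h (y \<bullet> z)) =
      (LINT z|distr sphere_measure sphere_measure f. h (y \<bullet> z))"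
    by (simp add: distr_sphere_measure_orthogonal_transformation[OF f(1)])
  also have "\<dots> = (LINT z|sphere_measure. h (f x \<bullet> f z))"
    by (subst integral_distr) (auto simp: f(2))
  also have "\<dots> = (LINT z|sphere_measure. h (x \<bullet> z))"
    using f(1) by (simp add: orthogonal_transformation_def)
  finally show ?thesis ..
qed

section \<open>Square integrability of truncated powers\<close>

lemma borel_measurable_trunc_power [measurable]:
  assumes [measurable]: "f \<in> borel_measurable M"
  shows "(\<lambda>x. trunc_power (f x) \<alpha>) \<in> borel_measurable M"
  unfolding trunc_power_def by measurable

text \<open>Substituting \<open>u = s - t\<close> leaves the integral of
  \<open>u powr (2 * \<beta> - 2)\<close> over a part of \<open>{0..2}\<close>, which converges at 0
  because the exponent exceeds -1. The bound does not depend on \<open>s\<close>, which later makes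
  it uniform over the sphere.\<close>

lemma nn_integral_trunc_power_le:
  assumes \<beta>: "\<beta> > 1 / 2" and s: "s \<le> 1"
  shows "(\<integral>\<^sup>+t. ennreal ((trunc_power (s - t) (\<beta> - 1))\<^sup>2) \<partial>restrict_space lborel {-1..1})
    \<le> ennreal (2 powr (2 * \<beta> - 1) / (2 * \<beta> - 1))"
proof -
  let ?g = "\<lambda>u. ennreal (indicator {0..2} u * u powr (2 * \<beta> - 2))"
  have pw: "(u powr (\<beta> - 1))\<^sup>2 = u powr (2 * \<beta> - 2)" for u :: real
    by (simp add: power2_eq_square flip: powr_add)
  have "(\<integral>\<^sup>+t. ennreal ((trunc_power (s - t) (\<beta> - 1))\<^sup>2) \<partial>restrict_space lborel {-1..1})
      = (\<integral>\<^sup>+t. ennreal ((trunc_power (s - t) (\<beta> - 1))\<^sup>2) * indicator {-1..1} t \<partial>lborel)"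
    by (rule nn_integral_restrict_space) simp
  also have "\<dots> \<le> (\<integral>\<^sup>+t. ?g (s - t) \<partial>lborel)"
    \<comment> \<open>The point \<open>t = s\<close> must be discarded: for
      \<open>\<beta> = 1\<close> the truncated power is 1 there, whereas
      \<open>0 powr 0 = 0\<close>.\<close>
    using AE_lborel_singleton[of s]
  proof (intro nn_integral_mono_AE, eventually_elim)
    fix t :: real assume "t \<noteq> s"
    with s show "ennreal ((trunc_power (s - t) (\<beta> - 1))\<^sup>2) * indicator {-1..1} t \<le> ?g (s - t)"
      by (auto simp: trunc_power_def pw split: split_indicator)
  qed
  also have "\<dots> = (\<integral>\<^sup>+u. ?g u \<partial>lborel)"
    by (rule nn_integral_lborel_diff) simp
  also have "\<dots> = ennreal (2 powr (2 * \<beta> - 2 + 1) / (2 * \<beta> - 2 + 1))"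
    using \<beta> by (intro nn_integral_has_integral_lebesgue has_integral_powr_from_0) auto
  finally show ?thesis by (simp add: algebra_simps)
qed

section \<open>Variance of averages and the invariance principle on abstract measure spaces\<close>

lemma integral_double_sum:
  fixes h :: "'i \<Rightarrow> 'j \<Rightarrow> 'a \<Rightarrow> 'b::{banach, second_countable_topology}"
  assumes "\<And>i j. i \<in> A \<Longrightarrow> j \<in> B \<Longrightarrow> integrable M (h i j)"
  shows "(LINT x|M. (\<Sum>i\<in>A. \<Sum>j\<in>B. h i j x)) = (\<Sum>i\<in>A. \<Sum>j\<in>B. LINT x|M. h i j x)"
proof -
  have "(LINT x|M. (\<Sum>i\<in>A. \<Sum>j\<in>B. h i j x)) = (\<Sum>i\<in>A. LINT x|M. (\<Sum>j\<in>B. h i j x))"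
    by (intro Bochner_Integration.integral_sum Bochner_Integration.integrable_sum assms)
  also have "\<dots> = (\<Sum>i\<in>A. \<Sum>j\<in>B. LINT x|M. h i j x)"
    by (intro sum.cong refl Bochner_Integration.integral_sum assms)
  finally show ?thesis .
qed

text \<open>The average of the \<open>g j\<close> again has mean \<open>m\<close>, so the left-hand
  side is its variance, the second moment minus \<open>m\<^sup>2\<close>. Expanding the square gives
  the double sum.\<close>

lemma (in prob_space) variance_average:
  fixes g :: "nat \<Rightarrow> 'a \<Rightarrow> real"
  assumes meas[measurable]: "\<And>j. j \<in> {1..N} \<Longrightarrow> g j \<in> borel_measurable M"
    and prod: "\<And>j k. j \<in> {1..N} \<Longrightarrow> k \<in> {1..N} \<Longrightarrow> integrable M (\<lambda>z. g j z * g k z)"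
    and mean: "\<And>j. j \<in> {1..N} \<Longrightarrow> expectation (g j) = m"
    and N: "N \<ge> 1"
  shows "expectation (\<lambda>z. \<bar>1 / real N * (\<Sum>j=1..N. g j z) - m\<bar>\<^sup>2)
    = 1 / (real N)\<^sup>2 * (\<Sum>j=1..N. \<Sum>k=1..N. expectation (\<lambda>z. g j z * g k z)) - m\<^sup>2"
proof -
  define G where "G = (\<lambda>z. 1 / real N * (\<Sum>j=1..N. g j z))"
  have sq: "(G z)\<^sup>2 = 1 / (real N)\<^sup>2 * (\<Sum>j=1..N. \<Sum>k=1..N. g j z * g k z)" for z
    by (simp add: G_def power2_eq_square sum_product)
  \<comment> \<open>The case \<open>j = k\<close> of \<open>prod\<close> is square integrability,
    which implies integrability on a probability space.\<close>
  have int: "integrable M (g j)" if "j \<in> {1..N}" for j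
    using that prod[of j j]
    by (intro square_integrable_imp_integrable[OF meas]) (simp_all add: power2_eq_square)
  have intG: "integrable M G"
    unfolding G_def by (intro Bochner_Integration.integrable_mult_right
        Bochner_Integration.integrable_sum int)
  have intG2: "integrable M (\<lambda>z. (G z)\<^sup>2)"
    unfolding sq by (intro Bochner_Integration.integrable_mult_right
        Bochner_Integration.integrable_sum prod)
  have EG: "expectation G = m"
    using N unfolding G_def by (subst Bochner_Integration.integral_mult_right)
      (auto simp: Bochner_Integration.integral_sum int mean)
  have "expectation (\<lambda>z. \<bar>G z - m\<bar>\<^sup>2) = expectation (\<lambda>z. (G z)\<^sup>2) - m\<^sup>2"
    using variance_eq[OF intG intG2] by (simp add: EG)
  also have "expectation (\<lambda>z. (G z)\<^sup>2) =
      1 / (real N)\<^sup>2 * (\<Sum>j=1..N. \<Sum>k=1..N. expectation (\<lambda>z. g j z * g k z))"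
    unfolding sq
    by (simp only: Bochner_Integration.integral_mult_right_zero integral_double_sum[OF prod])
  finally show ?thesis by (simp add: G_def)
qed

text \<open>The product is dominated by the sum of the squares.\<close>

lemma integrable_mult_if_integrable_squares:
  fixes f g :: "'a \<Rightarrow> real"
  assumes [measurable]: "f \<in> borel_measurable M" "g \<in> borel_measurable M"
    and "integrable M (\<lambda>x. (f x)\<^sup>2)" "integrable M (\<lambda>x. (g x)\<^sup>2)"
  shows "integrable M (\<lambda>x. f x * g x)"
proof (rule Bochner_Integration.integrable_bound)
  show "integrable M (\<lambda>x. (f x)\<^sup>2 + (g x)\<^sup>2)" using assms by simp
  have "norm (a * b) \<le> norm (a\<^sup>2 + b\<^sup>2)" for a b :: real
  proof -
    have "0 \<le> (\<bar>a\<bar> - \<bar>b\<bar>)\<^sup>2" by simp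
    then have "2 * (\<bar>a\<bar> * \<bar>b\<bar>) \<le> a\<^sup>2 + b\<^sup>2" by (simp add: power2_diff)
    then show ?thesis by (simp add: abs_mult) (smt (verit) abs_ge_zero mult_nonneg_nonneg)
  qed
  then show "AE x in M. norm (f x * g x) \<le> norm ((f x)\<^sup>2 + (g x)\<^sup>2)" by simp
qed simp

text \<open>The sphere enters only through \<open>bound\<close>, \<open>m1\<close> and
  \<open>m2\<close>. The subtracted mean over \<open>y\<close> equals the mean over
  \<open>z\<close>, so the inner integral is a variance; the same two identities collapse the double
  average of the kernel to the integral of \<open>(m t)\<^sup>2\<close>.\<close>

lemma invariance_principle:
  fixes f :: "'a \<Rightarrow> 't \<Rightarrow> 'a \<Rightarrow> real" and x :: "nat \<Rightarrow> 'a"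
  assumes T: "sigma_finite_measure T" and S: "prob_space S"
    and meas: "(\<lambda>(y, t, z). f y t z) \<in> borel_measurable (S \<Otimes>\<^sub>M T \<Otimes>\<^sub>M S)"
    and bound: "\<And>y. y \<in> space S \<Longrightarrow> (\<integral>\<^sup>+(t, z). ennreal ((f y t z)\<^sup>2) \<partial>(T \<Otimes>\<^sub>M S)) \<le> ennreal C"
    and m1: "\<And>y t. y \<in> space S \<Longrightarrow> t \<in> space T \<Longrightarrow> (LINT z|S. f y t z) = m t"
    and m2: "\<And>z t. z \<in> space S \<Longrightarrow> t \<in> space T \<Longrightarrow> (LINT y|S. f y t z) = m t"
    and N: "N \<ge> 1" and x: "\<And>j. j \<in> {1..N} \<Longrightarrow> x j \<in> space S"
  shows "(LINT t|T. LINT z|S.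
      \<bar>1 / real N * (\<Sum>j=1..N. f (x j) t z) - (LINT y|S. f y t z)\<bar>\<^sup>2)
    = 1 / (real N)\<^sup>2 * (\<Sum>j=1..N. \<Sum>k=1..N. LINT t|T. LINT z|S. f (x j) t z * f (x k) t z)
      - (LINT y|S. LINT x'|S. LINT t|T. LINT z|S. f x' t z * f y t z)"
proof -
  interpret S: prob_space S by fact
  interpret T: sigma_finite_measure T by fact
  interpret TS: pair_sigma_finite T S ..
  interpret STS: pair_sigma_finite S "T \<Otimes>\<^sub>M S" ..
  note [measurable] = meas
  have meas_fix[measurable]: "(\<lambda>(t, z). f y t z) \<in> borel_measurable (T \<Otimes>\<^sub>M S)" if "y \<in> space S" for y
    using measurable_compose[OF measurable_Pair1'[OF that] meas] by (simp add: case_prod_unfold)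
  have square: "integrable (T \<Otimes>\<^sub>M S) (\<lambda>(t, z). (f y t z)\<^sup>2)" if y: "y \<in> space S" for y
  proof (rule integrableI_bounded)
    show "(\<lambda>(t, z). (f y t z)\<^sup>2) \<in> borel_measurable (T \<Otimes>\<^sub>M S)"
      using meas_fix[OF y] by (auto simp: case_prod_unfold)
    show "(\<integral>\<^sup>+p. ennreal (norm (case p of (t, z) \<Rightarrow> (f y t z)\<^sup>2)) \<partial>(T \<Otimes>\<^sub>M S)) < \<infinity>"
      using bound[OF y] by (simp add: case_prod_unfold le_less_trans)
  qed
  have prod: "integrable (T \<Otimes>\<^sub>M S) (\<lambda>(t, z). f y t z * f y' t z)"
    if "y \<in> space S" "y' \<in> space S" for y y'
    using integrable_mult_if_integrable_squares[OF meas_fix meas_fix, OF that] square that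
    by (simp add: case_prod_unfold)
  \<comment> \<open>This justifies Fubini for the average over \<open>x'\<close>. The bound
    \<open>C\<close> is uniform and \<open>S\<close> has mass 1, so both factors are square
    integrable on the triple product, the second one being constant in \<open>x'\<close>.\<close>
  have triple: "integrable (S \<Otimes>\<^sub>M T \<Otimes>\<^sub>M S) (\<lambda>(x', t, z). f x' t z * f y t z)" if y: "y \<in> space S" for y
  proof -
    have my: "(\<lambda>(x', t, z). f y t z) \<in> borel_measurable (S \<Otimes>\<^sub>M T \<Otimes>\<^sub>M S)"
      using measurable_compose[OF measurable_snd meas_fix[OF y]] by (simp add: case_prod_unfold)
    have fin: "integrable (S \<Otimes>\<^sub>M T \<Otimes>\<^sub>M S) (\<lambda>p. (h p)\<^sup>2)"
      if [measurable]: "h \<in> borel_measurable (S \<Otimes>\<^sub>M T \<Otimes>\<^sub>M S)"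
        and h: "\<And>x'. x' \<in> space S \<Longrightarrow> (\<integral>\<^sup>+q. ennreal ((h (x', q))\<^sup>2) \<partial>(T \<Otimes>\<^sub>M S)) \<le> ennreal C"
      for h :: "'a \<times> 't \<times> 'a \<Rightarrow> real"
    proof (rule integrableI_bounded)
      have "(\<integral>\<^sup>+p. ennreal (norm ((h p)\<^sup>2)) \<partial>(S \<Otimes>\<^sub>M T \<Otimes>\<^sub>M S))
          = (\<integral>\<^sup>+x'. \<integral>\<^sup>+q. ennreal ((h (x', q))\<^sup>2) \<partial>(T \<Otimes>\<^sub>M S) \<partial>S)"
        by (subst TS.P.nn_integral_fst[symmetric]) auto
      also have "\<dots> \<le> (\<integral>\<^sup>+x'. ennreal C \<partial>S)"
        by (intro nn_integral_mono h)
      also have "\<dots> < \<infinity>" by (simp add: S.emeasure_space_1)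
      finally show "(\<integral>\<^sup>+p. ennreal (norm ((h p)\<^sup>2)) \<partial>(S \<Otimes>\<^sub>M T \<Otimes>\<^sub>M S)) < \<infinity>" .
    qed simp
    show ?thesis
      using integrable_mult_if_integrable_squares[OF meas my fin[OF meas] fin[OF my]]
        bound y by (simp add: case_prod_unfold)
  qed
  have K: "(LINT t|T. LINT z|S. f y t z * f y' t z) = (LINT (t, z)|(T \<Otimes>\<^sub>M S). f y t z * f y' t z)"
    if "y \<in> space S" "y' \<in> space S" for y y'
    by (rule TS.integral_fst[OF prod[OF that]])
  have mean: "integrable T (\<lambda>t. (m t)\<^sup>2)"
    "(LINT x'|S. LINT t|T. LINT z|S. f x' t z * f y t z) = (LINT t|T. (m t)\<^sup>2)"
    if y: "y \<in> space S" for y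
  proof -
    \<comment> \<open>With the average over \<open>x'\<close> taken innermost, \<open>m2\<close>
      yields one factor \<open>m t\<close>, and integrating over \<open>z\<close> yields the other
      by \<open>m1\<close>.\<close>
    let ?h = "\<lambda>t z. LINT x'|S. f x' t z * f y t z"
    have h: "?h t z = m t * f y t z" if "t \<in> space T" "z \<in> space S" for t z
      using m2[of z t] that by simp
    have h': "(LINT z|S. ?h t z) = (m t)\<^sup>2" if t: "t \<in> space T" for t
    proof -
      have "(LINT z|S. ?h t z) = (LINT z|S. m t * f y t z)"
        by (intro Bochner_Integration.integral_cong h t) auto
      then show ?thesis using m1[OF y t] by (simp add: power2_eq_square)
    qed
    have int: "integrable (T \<Otimes>\<^sub>M S) (\<lambda>(t, z). ?h t z)"
      using STS.integrable_snd[of "\<lambda>x' (t, z). f x' t z * f y t z"] triple[OF y]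
      by (simp add: case_prod_unfold)
    have "integrable T (\<lambda>t. LINT z|S. ?h t z)"
      by (rule TS.integrable_fst[OF int])
    then show "integrable T (\<lambda>t. (m t)\<^sup>2)"
      by (rule Bochner_Integration.integrable_cong[OF refl h', THEN iffD1, rotated])
    have "(LINT x'|S. LINT t|T. LINT z|S. f x' t z * f y t z)
        = (LINT x'|S. LINT q|(T \<Otimes>\<^sub>M S). (case q of (t, z) \<Rightarrow> f x' t z * f y t z))"
      by (intro Bochner_Integration.integral_cong) (auto simp: K y)
    also have "\<dots> = (LINT q|(T \<Otimes>\<^sub>M S). (case q of (t, z) \<Rightarrow> ?h t z))"
      using STS.Fubini_integral[of "\<lambda>x' (t, z). f x' t z * f y t z"] triple[OF y]
      by (simp add: case_prod_unfold)
    also have "\<dots> = (LINT t|T. LINT z|S. ?h t z)"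
      by (rule TS.integral_fst[OF int, symmetric])
    also have "\<dots> = (LINT t|T. (m t)\<^sup>2)"
      by (intro Bochner_Integration.integral_cong refl h')
    finally show "(LINT x'|S. LINT t|T. LINT z|S. f x' t z * f y t z) = (LINT t|T. (m t)\<^sup>2)" .
  qed
  have x1: "x 1 \<in> space S" using x N by simp
  have double: "(LINT y|S. LINT x'|S. LINT t|T. LINT z|S. f x' t z * f y t z) = (LINT t|T. (m t)\<^sup>2)"
  proof -
    have "(LINT y|S. LINT x'|S. LINT t|T. LINT z|S. f x' t z * f y t z) = (LINT y|S. LINT t|T. (m t)\<^sup>2)"
      by (intro Bochner_Integration.integral_cong) (auto simp: mean)
    then show ?thesis by (simp add: S.prob_space)
  qed
  \<comment> \<open>On \<open>space T\<close> the function \<open>m\<close> is a partial integral of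
    the jointly measurable \<open>f (x 1)\<close>.\<close>
  have m_meas[measurable]: "m \<in> borel_measurable T"
  proof -
    have "(\<lambda>t. LINT z|S. f (x 1) t z) \<in> borel_measurable T"
      using meas_fix[OF x1] by (rule S.borel_measurable_lebesgue_integral)
    then show ?thesis by (rule measurable_cong[THEN iffD1, rotated]) (rule m1[OF x1])
  qed
  have prod_fst: "integrable T (\<lambda>t. LINT z|S. f (x j) t z * f (x k) t z)"
    if "j \<in> {1..N}" "k \<in> {1..N}" for j k
    by (rule TS.integrable_fst[OF prod[OF x x, OF that]])
  let ?R = "\<lambda>t. 1 / (real N)\<^sup>2 * (\<Sum>j=1..N. \<Sum>k=1..N. LINT z|S. f (x j) t z * f (x k) t z)"
  have int_R: "integrable T ?R"
    by (intro Bochner_Integration.integrable_mult_right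
        Bochner_Integration.integrable_sum prod_fst)
  have meas_avg: "(\<lambda>(t, z). \<bar>1 / real N * (\<Sum>j=1..N. f (x j) t z) - m t\<bar>\<^sup>2)
      \<in> borel_measurable (T \<Otimes>\<^sub>M S)"
  proof -
    have "(\<lambda>p. \<Sum>j=1..N. f (x j) (fst p) (snd p)) \<in> borel_measurable (T \<Otimes>\<^sub>M S)"
      using meas_fix[OF x] by (intro borel_measurable_sum) (simp add: case_prod_unfold)
    then show ?thesis by (simp add: case_prod_unfold)
  qed
  have "(LINT t|T. LINT z|S. \<bar>1 / real N * (\<Sum>j=1..N. f (x j) t z) - (LINT y|S. f y t z)\<bar>\<^sup>2)
      = (LINT t|T. LINT z|S. \<bar>1 / real N * (\<Sum>j=1..N. f (x j) t z) - m t\<bar>\<^sup>2)"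
    by (intro Bochner_Integration.integral_cong) (auto simp: m2)
  also have "\<dots> = (LINT t|T. ?R t - (m t)\<^sup>2)"
  proof (rule integral_cong_AE)
    show "(\<lambda>t. LINT z|S. \<bar>1 / real N * (\<Sum>j=1..N. f (x j) t z) - m t\<bar>\<^sup>2) \<in> borel_measurable T"
      by (rule S.borel_measurable_lebesgue_integral[OF meas_avg])
    show "(\<lambda>t. ?R t - (m t)\<^sup>2) \<in> borel_measurable T"
      using int_R by simp
    \<comment> \<open>Integrability on the product space passes to the slices only for almost every
      \<open>t\<close>; finitely many exceptional null sets are united.\<close>
    have "AE t in T. \<forall>j\<in>{1..N}. \<forall>k\<in>{1..N}. integrable S (\<lambda>z. f (x j) t z * f (x k) t z)"
      using TS.AE_integrable_fst[OF prod[OF x x]] by (intro AE_finite_allI) auto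
    then show "AE t in T. (LINT z|S. \<bar>1 / real N * (\<Sum>j=1..N. f (x j) t z) - m t\<bar>\<^sup>2) = ?R t - (m t)\<^sup>2"
      using AE_space
    proof eventually_elim
      case (elim t)
      have "f (x j) t \<in> borel_measurable S" if "j \<in> {1..N}" for j
        using measurable_Pair2[OF meas_fix[OF x[OF that]] elim(2)] by simp
      with elim N show ?case
        by (intro S.variance_average) (auto simp: m1 x)
    qed
  qed
  also have "\<dots> = (LINT t|T. ?R t) - (LINT t|T. (m t)\<^sup>2)"
    by (rule Bochner_Integration.integral_diff[OF int_R mean(1)[OF x1]])
  also have "(LINT t|T. ?R t)
      = 1 / (real N)\<^sup>2 * (\<Sum>j=1..N. \<Sum>k=1..N. LINT t|T. LINT z|S. f (x j) t z * f (x k) t z)"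
    by (simp only: Bochner_Integration.integral_mult_right_zero integral_double_sum[OF prod_fst])
  finally show ?thesis by (simp only: double)
qed

section \<open>Specialization to the sphere\<close>

text \<open>Turns the set integral into an integral over a measure space of its own, which can serve
  as the factor \<open>T\<close> of a product measure.\<close>

lemma sphere_kernel_eq_integral_restrict_space:
  "sphere_kernel \<beta> x y = (LINT t|restrict_space lborel {-1..1}. LINT z|sphere_measure.
     trunc_power (x \<bullet> z - t) (\<beta> - 1) * trunc_power (y \<bullet> z - t) (\<beta> - 1))"
  by (simp add: sphere_kernel_def set_lebesgue_integral_def integral_restrict_space)

theorem theorem3:
  fixes d N :: nat and \<beta> :: real and x :: "nat \<Rightarrow> real ^ 'n"
  assumes "d \<ge> 2"
    and "CARD('n) = d + 1"
    and "\<beta> > 1 / 2"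
    and "N \<ge> 1"
    and "\<And>j. j \<in> {1..N} \<Longrightarrow> x j \<in> sphere 0 1"
  shows "(LBINT t:{-1..1}. LINT z|(sphere_measure :: (real ^ 'n) measure).
            \<bar>1 / real N * (\<Sum>j=1..N. trunc_power (x j \<bullet> z - t) (\<beta> - 1))
              - (LINT y|(sphere_measure :: (real ^ 'n) measure). trunc_power (y \<bullet> z - t) (\<beta> - 1))\<bar>\<^sup>2)
         = 1 / (real N)\<^sup>2 * (\<Sum>j=1..N. \<Sum>k=1..N. sphere_kernel \<beta> (x j) (x k))
           - (LINT y|(sphere_measure :: (real ^ 'n) measure).
                LINT x'|(sphere_measure :: (real ^ 'n) measure). sphere_kernel \<beta> x' y)"
proof -
  let ?S = "sphere_measure :: (real ^ 'n) measure"
  let ?T = "restrict_space lborel {-1..1} :: real measure"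
  let ?f = "\<lambda>(y :: real ^ 'n) (t :: real) z. trunc_power (y \<bullet> z - t) (\<beta> - 1)"
  \<comment> \<open>Any unit vector could replace \<open>x 1\<close>, as \<open>zonal\<close> shows;
    \<open>N \<ge> 1\<close> ensures that \<open>x 1\<close> is one of the given points.\<close>
  define m where "m = (\<lambda>t. LINT z|?S. ?f (x 1) t z)"
  have x1: "x 1 \<in> sphere 0 1"
    using assms(4,5) by simp
  interpret S: prob_space ?S by (rule prob_space_sphere_measure)
  have T: "sigma_finite_measure ?T"
    by (intro sigma_finite_measure_restrict_space lborel.sigma_finite_measure_axioms) simp
  then interpret T: sigma_finite_measure ?T .
  interpret TS: pair_sigma_finite ?T ?S ..
  have T_borel: "(\<lambda>t. t) \<in> borel_measurable ?T"
    by (intro measurable_restrict_space1) simp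
  have meas: "(\<lambda>(y, t, z). ?f y t z) \<in> borel_measurable (?S \<Otimes>\<^sub>M ?T \<Otimes>\<^sub>M ?S)"
  proof -
    note [measurable] =
      measurable_compose[OF measurable_fst measurable_ident_sphere_measure]
      measurable_compose[OF measurable_snd measurable_compose[OF measurable_fst T_borel]]
      measurable_compose[OF measurable_snd
        measurable_compose[OF measurable_snd measurable_ident_sphere_measure]]
    show ?thesis unfolding case_prod_unfold by measurable
  qed
  have zonal: "(LINT z|?S. ?f y t z) = m t" if "y \<in> sphere 0 1" for y t
    unfolding m_def
    by (rule integral_sphere_measure_zonal_eq[of "\<lambda>u. trunc_power (u - t) (\<beta> - 1)"])
      (use that x1 in auto)
  \<comment> \<open>Integrating over \<open>t\<close> first, by Tonelli, reduces this to the
    one-dimensional estimate at \<open>s = y \<bullet> z\<close>, where Cauchy-Schwarz gives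
    \<open>s \<le> 1\<close>.\<close>
  have bound: "(\<integral>\<^sup>+(t, z). ennreal ((?f y t z)\<^sup>2) \<partial>(?T \<Otimes>\<^sub>M ?S))
      \<le> ennreal (2 powr (2 * \<beta> - 1) / (2 * \<beta> - 1))" if y: "y \<in> space ?S" for y
  proof -
    have my: "(\<lambda>(t, z). ?f y t z) \<in> borel_measurable (?T \<Otimes>\<^sub>M ?S)"
      using measurable_compose[OF measurable_Pair1'[OF y] meas] by (simp add: case_prod_unfold)
    have "(\<integral>\<^sup>+(t, z). ennreal ((?f y t z)\<^sup>2) \<partial>(?T \<Otimes>\<^sub>M ?S))
        = (\<integral>\<^sup>+z. \<integral>\<^sup>+t. ennreal ((?f y t z)\<^sup>2) \<partial>?T \<partial>?S)"
      using my TS.nn_integral_snd[of "\<lambda>(t, z). ennreal ((?f y t z)\<^sup>2)"]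
      by (simp add: case_prod_unfold)
    also have "\<dots> \<le> (\<integral>\<^sup>+z. ennreal (2 powr (2 * \<beta> - 1) / (2 * \<beta> - 1)) \<partial>?S)"
    proof (intro nn_integral_mono nn_integral_trunc_power_le assms(3))
      fix z assume "z \<in> space ?S"
      with y show "y \<bullet> z \<le> 1"
        using norm_cauchy_schwarz[of y z] by simp
    qed
    finally show ?thesis by (simp add: S.emeasure_space_1[simplified])
  qed
  show ?thesis
    \<comment> \<open>Both mean-value hypotheses come from \<open>zonal\<close>, the one for the
      average over \<open>y\<close> through the symmetry of the inner product.\<close>
    using invariance_principle[OF T prob_space_sphere_measure meas bound, of m N x] zonal assms(4,5)
    by (simp add: sphere_kernel_eq_integral_restrict_space set_lebesgue_integral_def
        integral_restrict_space inner_commute)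
qed

end
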